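(* Let $X$ and $X'$ be fibrewise pointed spaces over $B$, and let $\pi\colon E\to X$ and $\pi'\colon E'\to X'$ be fibrewise fibrations with fibres $F=\pi^{-1}(s_X(B))$ and $F'=(\pi')^{-1}(s_{X'}(B))$, respectively. For $i=1,\dots,r$ let $f_i\colon E\to E'$ be fibrewise maps over $B$ with $f_i(F)\subseteq F'$, and denote by $f_i^0=f_i|_F\colon F\to F'$ the induced maps on the fibres. Then $$D_B(f_1,\dots,f_r)+1\le \bigl(D_B(f_1^0,\dots,f_r^0)+1\bigr)\cdot\bigl(\mathrm{cat}_B^*(X)+1\bigr).$$
   Context: All spaces are topological spaces, all maps are continuous, $I=[0,1]$. A fibrewise space over $B$ is a space $X$ with a map $p_X\colon X\to B$; a fibrewise map $f\colon X\to Y$ satisfies $p_Y\circ f=p_X$. Subspaces (e.g. $F\subseteq E$, $F'\subseteq E'$) are fibrewise spaces over $B$ by restriction. $f\simeq_B g$ means there is $H\colon X\times I\to Y$ with $p_Y(H(x,t))=p_X(x)$ (a fibrewise homotopy), $H(\cdot,0)=f$, $H(\cdot,1)=g$. A fibrewise pointed space over $B$ is a fibrewise space $X$ with a section $s_X\colon B\to X$ of $p_X$. A fibrewise map $p\colon E\to Y$ over $B$ is a fibrewise fibration if it has the homotopy lifting property for fibrewise spaces: for every fibrewise space $Z$, fibrewise map $f\colon Z\to E$ and fibrewise homotopy $H\colon Z\times I\to Y$ with $H(\cdot,0)=p\circ f$, there is a fibrewise homotopy $\widetilde H\colon Z\times I\to E$ with $p\circ\widetilde H=H$ and $\widetilde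 H(\cdot,0)=f$. For fibrewise maps $f_1,\dots,f_r\colon X\to Y$, $D_B(f_1,\dots,f_r)$ is the least $n\ge 0$ (or $\infty$) such that $X$ has an open cover $\{U_0,\dots,U_n\}$ with $f_s|_{U_i}\simeq_B f_t|_{U_i}$ for all $0\le i\le n$, $1\le s,t\le r$. For a fibrewise pointed space $X$, $\mathrm{cat}_B^*(X)$ is the least $n\ge 0$ (or $\infty$) such that $X$ has an open cover $\{U_0,\dots,U_n\}$ with the inclusion $U_i\hookrightarrow X$ fibrewise homotopic to $s_X\circ p_X|_{U_i}$ for every $i$. *)

theory Defs
  imports "HOL-Analysis.Analysis" "HOL-Library.Extended_Nat"
begin

text \<open>
  A fibrewise space over \<open>B\<close> is given by a topology \<open>X\<close> and a projection \<open>pX\<close>, where only the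
  values of \<open>pX\<close> on \<^term>\<open>topspace X\<close> matter. A subspace \<open>F\<close> of \<open>X\<close> is the fibrewise space
  given by \<^term>\<open>subtopology X F\<close> and the same \<open>pX\<close>, and the restriction of a map to \<open>F\<close> is
  represented by the map itself.
\<close>

definition fibrewise_space :: "'b topology \<Rightarrow> 'x topology \<Rightarrow> ('x \<Rightarrow> 'b) \<Rightarrow> bool" where
  "fibrewise_space B X pX \<longleftrightarrow> continuous_map X B pX"

definition fibrewise_map ::
    "'x topology \<Rightarrow> ('x \<Rightarrow> 'b) \<Rightarrow> 'y topology \<Rightarrow> ('y \<Rightarrow> 'b) \<Rightarrow> ('x \<Rightarrow> 'y) \<Rightarrow> bool" where
  "fibrewise_map X pX Y pY f \<longleftrightarrow>
     continuous_map X Y f \<and> (\<forall>x\<in>topspace X. pY (f x) = pX x)"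

definition fibrewise_pointed_space ::
    "'b topology \<Rightarrow> 'x topology \<Rightarrow> ('x \<Rightarrow> 'b) \<Rightarrow> ('b \<Rightarrow> 'x) \<Rightarrow> bool" where
  "fibrewise_pointed_space B X pX sX \<longleftrightarrow>
     fibrewise_space B X pX \<and> continuous_map B X sX \<and> (\<forall>b\<in>topspace B. pX (sX b) = b)"

text \<open>As in \<^const>\<open>homotopic_with\<close>, the time parameter is the first component.\<close>

definition fibrewise_homotopy ::
    "'x topology \<Rightarrow> ('x \<Rightarrow> 'b) \<Rightarrow> 'y topology \<Rightarrow> ('y \<Rightarrow> 'b) \<Rightarrow> (real \<times> 'x \<Rightarrow> 'y) \<Rightarrow> bool" where
  "fibrewise_homotopy X pX Y pY H \<longleftrightarrow>
     continuous_map (prod_topology (top_of_set {0..1}) X) Y H \<and>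
     (\<forall>t\<in>{0..1}. \<forall>x\<in>topspace X. pY (H (t, x)) = pX x)"

definition fibrewise_homotopic ::
    "'x topology \<Rightarrow> ('x \<Rightarrow> 'b) \<Rightarrow> 'y topology \<Rightarrow> ('y \<Rightarrow> 'b) \<Rightarrow> ('x \<Rightarrow> 'y) \<Rightarrow> ('x \<Rightarrow> 'y) \<Rightarrow> bool" where
  "fibrewise_homotopic X pX Y pY f g \<longleftrightarrow>
     homotopic_with (\<lambda>h. \<forall>x\<in>topspace X. pY (h x) = pX x) X Y f g"

text \<open>
  \<^const>\<open>homotopic_with\<close> prescribes the ends of the homotopy also outside \<^term>\<open>topspace X\<close>;
  this makes no difference.
\<close>

lemma fibrewise_homotopic_iff:
  "fibrewise_homotopic X pX Y pY f g \<longleftrightarrow>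
     (\<exists>H. fibrewise_homotopy X pX Y pY H \<and>
          (\<forall>x\<in>topspace X. H (0, x) = f x) \<and> (\<forall>x\<in>topspace X. H (1, x) = g x))"
  unfolding fibrewise_homotopic_def fibrewise_homotopy_def
  by (subst homotopic_with) auto

text \<open>
  The homotopy lifting property over \<open>B\<close>, for test spaces \<open>Z\<close> of one particular type: a definition
  cannot quantify over all types. The type is large enough for this to be no restriction, as shown
  by the theorem following the definition, in which the type of \<open>Z\<close> is arbitrary: the map
  sending \<open>z\<close> to the pair of \<open>f z\<close> and the path \<open>\<lambda>t. H (t, z)\<close> factors any lifting problem
  through a quotient of \<open>Z\<close> that lives in the type used here, and taking the product with \<open>[0,1]\<close>
  preserves quotient maps.
\<close>

definition fibrewise_fibration ::
    "'b topology \<Rightarrow> 'e topology \<Rightarrow> ('e \<Rightarrow> 'b) \<Rightarrow> 'y topology \<Rightarrow> ('y \<Rightarrow> 'b) \<Rightarrow> ('e \<Rightarrow> 'y) \<Rightarrow> bool" where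
  "fibrewise_fibration B E pE Y pY p \<longleftrightarrow>
     fibrewise_map E pE Y pY p \<and>
     (\<forall>(Z :: ('e \<times> (real \<Rightarrow> 'y)) topology) pZ f H.
        fibrewise_space B Z pZ \<and> fibrewise_map Z pZ E pE f \<and> fibrewise_homotopy Z pZ Y pY H \<and>
        (\<forall>z\<in>topspace Z. H (0, z) = p (f z)) \<longrightarrow>
        (\<exists>H'. fibrewise_homotopy Z pZ E pE H' \<and>
              (\<forall>t\<in>{0..1}. \<forall>z\<in>topspace Z. p (H' (t, z)) = H (t, z)) \<and>
              (\<forall>z\<in>topspace Z. H' (0, z) = f z)))"

theorem fibrewise_fibration_lifting:
  fixes Z :: "'z topology"
  assumes fib: "fibrewise_fibration B E pE Y pY p"
    and E: "fibrewise_space B E pE"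
    and Z: "fibrewise_space B Z pZ"
    and f: "fibrewise_map Z pZ E pE f"
    and H: "fibrewise_homotopy Z pZ Y pY H"
    and H0: "\<And>z. z \<in> topspace Z \<Longrightarrow> H (0, z) = p (f z)"
  shows "\<exists>H'. fibrewise_homotopy Z pZ E pE H' \<and>
              (\<forall>t\<in>{0..1}. \<forall>z\<in>topspace Z. p (H' (t, z)) = H (t, z)) \<and>
              (\<forall>z\<in>topspace Z. H' (0, z) = f z)"
proof -
  define q where "q = (\<lambda>z. (f z, \<lambda>t. H (t, z)))"
  define Q where
    "Q = topology (\<lambda>U. U \<subseteq> q ` topspace Z \<and> openin Z {z \<in> topspace Z. q z \<in> U})"
  have ist: "istopology (\<lambda>U. U \<subseteq> q ` topspace Z \<and> openin Z {z \<in> topspace Z. q z \<in> U})"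
  proof -
    have 1: "{z \<in> topspace Z. q z \<in> S \<inter> T} =
        {z \<in> topspace Z. q z \<in> S} \<inter> {z \<in> topspace Z. q z \<in> T}" for S T
      by blast
    have 2: "{z \<in> topspace Z. q z \<in> \<Union>K} = (\<Union>S\<in>K. {z \<in> topspace Z. q z \<in> S})" for K
      by blast
    show ?thesis
      unfolding istopology_def 1 2 by blast
  qed
  have openQ: "openin Q U \<longleftrightarrow> U \<subseteq> q ` topspace Z \<and> openin Z {z \<in> topspace Z. q z \<in> U}" for U
    unfolding Q_def using topology_inverse'[OF ist] by simp
  have "{z \<in> topspace Z. q z \<in> q ` topspace Z} = topspace Z"
    by blast
  then have topQ: "topspace Q = q ` topspace Z"
    by (metis openQ openin_subset openin_topspace order_refl subset_antisym)
  have quo: "quotient_map Z Q q"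
    unfolding quotient_map_def topQ openQ by auto
  have quoI: "quotient_map (prod_topology (top_of_set {0..1::real}) Z)
      (prod_topology (top_of_set {0..1}) Q) (\<lambda>(t, z). (t, q z))"
    by (intro quotient_map_prod_right quo disjI1)
       (simp_all add: compact_imp_locally_compact_space compact_space_subtopology Hausdorff_space_subtopology)
  have pE: "pE (f z) = pZ z" if "z \<in> topspace Z" for z
    using f that by (simp add: fibrewise_map_def)
  have 1: "fibrewise_map Q (pE \<circ> fst) E pE fst"
    unfolding fibrewise_map_def
  proof (intro conjI)
    show "continuous_map Q E fst"
      by (rule continuous_compose_quotient_map[OF quo])
         (use f in \<open>simp add: fibrewise_map_def q_def o_def\<close>)
  qed simp
  then have 2: "fibrewise_space B Q (pE \<circ> fst)"
    using E by (auto simp: fibrewise_map_def fibrewise_space_def intro: continuous_map_compose)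
  have 3: "fibrewise_homotopy Q (pE \<circ> fst) Y pY (\<lambda>(t, w). snd w t)"
    unfolding fibrewise_homotopy_def
  proof (intro conjI)
    have "(\<lambda>(t, w). snd w t) \<circ> (\<lambda>(t, z). (t, q z)) = H"
      by (auto simp: q_def)
    then show "continuous_map (prod_topology (top_of_set {0..1}) Q) Y (\<lambda>(t, w). snd w t)"
      using H by (intro continuous_compose_quotient_map[OF quoI]) (simp only: fibrewise_homotopy_def)
    show "\<forall>t\<in>{0..1}. \<forall>w\<in>topspace Q. pY ((\<lambda>(t, w). snd w t) (t, w)) = (pE \<circ> fst) w"
      using H pE by (auto simp: topQ q_def fibrewise_homotopy_def)
  qed
  have "\<forall>w\<in>topspace Q. (\<lambda>(t, w). snd w t) (0, w) = p (fst w)"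
    using H0 by (auto simp: topQ q_def)
  then obtain G where G: "fibrewise_homotopy Q (pE \<circ> fst) E pE G"
      "\<forall>t\<in>{0..1}. \<forall>w\<in>topspace Q. p (G (t, w)) = (\<lambda>(t, w). snd w t) (t, w)"
      "\<forall>w\<in>topspace Q. G (0, w) = fst w"
    using fib 1 2 3 unfolding fibrewise_fibration_def by blast
  show ?thesis
  proof (intro exI conjI)
    show "fibrewise_homotopy Z pZ E pE (G \<circ> (\<lambda>(t, z). (t, q z)))"
      unfolding fibrewise_homotopy_def
    proof (intro conjI)
      show "continuous_map (prod_topology (top_of_set {0..1}) Z) E (G \<circ> (\<lambda>(t, z). (t, q z)))"
        using G(1) quotient_imp_continuous_map[OF quoI]
        by (auto simp: fibrewise_homotopy_def intro: continuous_map_compose)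
      show "\<forall>t\<in>{0..1}. \<forall>z\<in>topspace Z. pE ((G \<circ> (\<lambda>(t, z). (t, q z))) (t, z)) = pZ z"
        using G(1) pE by (simp add: fibrewise_homotopy_def topQ) (simp add: q_def)
    qed
  qed (use G(2,3) in \<open>auto simp: topQ q_def\<close>)
qed

text \<open>
  The covers are indexed by \<open>{..n}\<close>, and the infimum of the empty set is \<open>\<infinity>\<close>.
\<close>

definition fibrewise_distance ::
    "'x topology \<Rightarrow> ('x \<Rightarrow> 'b) \<Rightarrow> 'y topology \<Rightarrow> ('y \<Rightarrow> 'b) \<Rightarrow> nat \<Rightarrow> (nat \<Rightarrow> 'x \<Rightarrow> 'y) \<Rightarrow> enat" where
  "fibrewise_distance X pX Y pY r f =
     Inf {enat n | n. \<exists>U :: nat \<Rightarrow> 'x set.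
       (\<forall>i\<le>n. openin X (U i)) \<and> (\<Union>i\<le>n. U i) = topspace X \<and>
       (\<forall>i\<le>n. \<forall>s\<in>{1..r}. \<forall>t\<in>{1..r}.
          fibrewise_homotopic (subtopology X (U i)) pX Y pY (f s) (f t))}"

definition fibrewise_cat :: "'x topology \<Rightarrow> ('x \<Rightarrow> 'b) \<Rightarrow> ('b \<Rightarrow> 'x) \<Rightarrow> enat" where
  "fibrewise_cat X pX sX =
     Inf {enat n | n. \<exists>U :: nat \<Rightarrow> 'x set.
       (\<forall>i\<le>n. openin X (U i)) \<and> (\<Union>i\<le>n. U i) = topspace X \<and>
       (\<forall>i\<le>n. fibrewise_homotopic (subtopology X (U i)) pX X pX id (sX \<circ> pX))}"

end

theory Submission
  imports Defs
begin

text \<open>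
  Let \<open>U\<close> be an open subset of \<open>X\<close> that is fibrewise contractible in \<open>X\<close> to the section.
  Lifting the contraction along the fibration deforms \<open>\<pi>\<^sup>-\<^sup>1(U)\<close> inside \<open>E\<close>, over \<open>B\<close>, by a
  homotopy from the inclusion to a map \<open>g\<close> with values in the fibre \<open>F\<close>
  (\<open>fibrewise_fibration_deformation\<close>). If now \<open>V\<close> is an open subset of \<open>F\<close> on which the maps
  \<open>f\<^sub>i\<close> are fibrewise homotopic, then on the open set \<open>{e \<in> \<pi>\<^sup>-\<^sup>1(U). g e \<in> V}\<close> there are fibrewise
  homotopies
  \<open>f\<^sub>s \<simeq> f\<^sub>s \<circ> g \<simeq> f\<^sub>t \<circ> g \<simeq> f\<^sub>t\<close>, the outer two induced by the deformation and the middle one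
  by the homotopy on \<open>V\<close> (\<open>fibrewise_homotopic_on_deformed_preimage\<close>). As \<open>U\<close> and \<open>V\<close> run
  through optimal covers of \<open>X\<close> and of \<open>F\<close>, these sets cover \<open>E\<close>, and their number is the
  product of the sizes of the two covers.
\<close>

lemma fibrewise_homotopic_sym:
  "fibrewise_homotopic X pX Y pY f g \<Longrightarrow> fibrewise_homotopic X pX Y pY g f"
  unfolding fibrewise_homotopic_def by (rule homotopic_with_symD)

lemma fibrewise_homotopic_trans:
  "fibrewise_homotopic X pX Y pY f g \<Longrightarrow> fibrewise_homotopic X pX Y pY g h \<Longrightarrow>
     fibrewise_homotopic X pX Y pY f h"
  unfolding fibrewise_homotopic_def by (rule homotopic_with_trans)

lemma fibrewise_homotopic_compose_left:
  assumes "fibrewise_homotopic X pX Y pY f g" and "fibrewise_map Y pY Z pZ h"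
  shows "fibrewise_homotopic X pX Z pZ (h \<circ> f) (h \<circ> g)"
  unfolding fibrewise_homotopic_def
proof (rule homotopic_with_compose_continuous_map_left)
  show "homotopic_with (\<lambda>k. continuous_map X Y k \<and> (\<forall>x\<in>topspace X. pY (k x) = pX x)) X Y f g"
    using assms(1) unfolding fibrewise_homotopic_def
    by (rule homotopic_with_mono) auto
  show "continuous_map Y Z h"
    using assms(2) by (simp add: fibrewise_map_def)
  show "\<forall>x\<in>topspace X. pZ ((h \<circ> k) x) = pX x"
    if "continuous_map X Y k \<and> (\<forall>x\<in>topspace X. pY (k x) = pX x)" for k
    using assms(2) that continuous_map_image_subset_topspace
    by (fastforce simp: fibrewise_map_def)
qed

lemma fibrewise_homotopic_compose_right:
  assumes "fibrewise_homotopic X pX Y pY f g" and "fibrewise_map W pW X pX h"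
  shows "fibrewise_homotopic W pW Y pY (f \<circ> h) (g \<circ> h)"
  unfolding fibrewise_homotopic_def
proof (rule homotopic_with_compose_continuous_map_right)
  show "homotopic_with (\<lambda>k. \<forall>x\<in>topspace X. pY (k x) = pX x) X Y f g"
    using assms(1) by (simp add: fibrewise_homotopic_def)
  show "continuous_map W X h"
    using assms(2) by (simp add: fibrewise_map_def)
  show "\<forall>w\<in>topspace W. pY ((k \<circ> h) w) = pW w" if "\<forall>x\<in>topspace X. pY (k x) = pX x" for k
    using assms(2) that continuous_map_image_subset_topspace
    by (fastforce simp: fibrewise_map_def)
qed

lemma fibrewise_map_subtopology_inclusion:
  "fibrewise_map (subtopology X S) pX X pX id"
  by (simp add: fibrewise_map_def continuous_map_from_subtopology)

lemma fibrewise_homotopic_subtopology: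
  assumes "fibrewise_homotopic X pX Y pY f g"
  shows "fibrewise_homotopic (subtopology X S) pX Y pY f g"
  using fibrewise_homotopic_compose_right[OF assms fibrewise_map_subtopology_inclusion] by simp

text \<open>
  This is the only use of the homotopy lifting property. It is applied to the test space
  \<open>p\<^sup>-\<^sup>1(U)\<close>, its inclusion into \<open>E\<close>, and the given homotopy precomposed with \<open>p\<close>; the end of the
  lifted homotopy lies over \<open>g(U) \<subseteq> A\<close>.
\<close>

lemma fibrewise_fibration_deformation:
  assumes fib: "fibrewise_fibration B E pE Y pY p"
    and E: "fibrewise_space B E pE"
    and g: "fibrewise_homotopic (subtopology Y U) pY Y pY id g"
    and gA: "\<And>y. y \<in> topspace Y \<Longrightarrow> y \<in> U \<Longrightarrow> g y \<in> A"
  defines "P \<equiv> subtopology E {e \<in> topspace E. p e \<in> U}"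
    and "F \<equiv> {e \<in> topspace E. p e \<in> A}"
  obtains d where "fibrewise_map P pE (subtopology E F) pE d"
    and "fibrewise_homotopic P pE E pE id d"
proof -
  have p: "continuous_map E Y p" "\<And>e. e \<in> topspace E \<Longrightarrow> pY (p e) = pE e"
    using fib by (auto simp: fibrewise_fibration_def fibrewise_map_def)
  have pP: "fibrewise_map P pE (subtopology Y U) pY p"
    using p by (auto simp: fibrewise_map_def P_def continuous_map_in_subtopology
        continuous_map_from_subtopology)
  have "fibrewise_homotopic P pE Y pY p (g \<circ> p)"
    using fibrewise_homotopic_compose_right[OF g pP] by simp
  then obtain H where H: "fibrewise_homotopy P pE Y pY H"
    "\<And>e. e \<in> topspace P \<Longrightarrow> H (0, e) = p e" "\<And>e. e \<in> topspace P \<Longrightarrow> H (1, e) = g (p e)"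
    unfolding fibrewise_homotopic_iff by auto
  have i: "fibrewise_map P pE E pE id"
    unfolding P_def by (rule fibrewise_map_subtopology_inclusion)
  have "fibrewise_space B P pE"
    using E by (simp add: fibrewise_space_def P_def continuous_map_from_subtopology)
  from fibrewise_fibration_lifting[OF fib E this i H(1)] H(2)
  obtain K where K: "fibrewise_homotopy P pE E pE K"
    "\<And>t e. t \<in> {0..1} \<Longrightarrow> e \<in> topspace P \<Longrightarrow> p (K (t, e)) = H (t, e)"
    "\<And>e. e \<in> topspace P \<Longrightarrow> K (0, e) = e"
    by auto
  define d where "d = (\<lambda>e. K (1, e))"
  have "continuous_map P (prod_topology (top_of_set {0..1::real}) P) (\<lambda>e. (1, e))"
    by (intro continuous_map_pairedI) auto
  then have d: "continuous_map P E d"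
    using K(1) continuous_map_compose unfolding fibrewise_homotopy_def d_def
    by (fastforce simp: o_def)
  have "p (d e) \<in> A" if e: "e \<in> topspace P" for e
  proof -
    have "p e \<in> topspace Y" "p e \<in> U"
      using e p(1) continuous_map_image_subset_topspace by (fastforce simp: P_def)+
    then show ?thesis
      using K(2)[of 1 e] H(3)[OF e] gA e by (simp add: d_def)
  qed
  moreover have "d e \<in> topspace E" if "e \<in> topspace P" for e
    using d that continuous_map_image_subset_topspace by fastforce
  ultimately have "fibrewise_map P pE (subtopology E F) pE d"
    using d K(1)
    by (auto simp: fibrewise_map_def continuous_map_in_subtopology F_def
        fibrewise_homotopy_def d_def)
  moreover have "fibrewise_homotopic P pE E pE id d"
    unfolding fibrewise_homotopic_iff using K(1,3) by (auto simp: d_def)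
  ultimately show ?thesis
    by (rule that)
qed

text \<open>
  The composite homotopy \<open>h \<simeq> h \<circ> d \<simeq> k \<circ> d \<simeq> k\<close>.
\<close>

lemma fibrewise_homotopic_on_deformed_preimage:
  assumes d: "fibrewise_map (subtopology E S) pE (subtopology E F) pE d"
    and id_d: "fibrewise_homotopic (subtopology E S) pE E pE id d"
    and h: "fibrewise_map E pE E' pE' h" and k: "fibrewise_map E pE E' pE' k"
    and hk: "fibrewise_homotopic (subtopology (subtopology E F) V) pE (subtopology E' F') pE' h k"
  defines "W \<equiv> {e \<in> topspace (subtopology E S). d e \<in> V}"
  shows "fibrewise_homotopic (subtopology E W) pE E' pE' h k"
proof -
  have W: "subtopology E W = subtopology (subtopology E S) W"
    by (auto simp: subtopology_subtopology W_def intro: arg_cong[where f = "subtopology E"])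
  have "fibrewise_homotopic (subtopology E W) pE E pE id d"
    unfolding W by (rule fibrewise_homotopic_subtopology[OF id_d])
  then have l: "fibrewise_homotopic (subtopology E W) pE E' pE' l (l \<circ> d)"
    if "fibrewise_map E pE E' pE' l" for l
    using fibrewise_homotopic_compose_left that by fastforce
  have dW: "fibrewise_map (subtopology E W) pE (subtopology (subtopology E F) V) pE d"
    using d unfolding W fibrewise_map_def
    by (auto simp: continuous_map_in_subtopology continuous_map_from_subtopology W_def)
  have "fibrewise_homotopic (subtopology (subtopology E F) V) pE E' pE' h k"
    using fibrewise_homotopic_compose_left[OF hk fibrewise_map_subtopology_inclusion] by simp
  then have "fibrewise_homotopic (subtopology E W) pE E' pE' (h \<circ> d) (k \<circ> d)"
    using dW by (rule fibrewise_homotopic_compose_right)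
  then show ?thesis
    using l[OF h] l[OF k] by (meson fibrewise_homotopic_sym fibrewise_homotopic_trans)
qed

lemma Inf_eq_enat_attained:
  assumes "Inf {enat n |n. P n} = enat m"
  shows "P m"
proof -
  have "{enat n |n. P n} \<noteq> {}"
  proof
    assume "{enat n |n. P n} = {}"
    with assms show False
      by (simp only: Inf_enat_def if_True) simp
  qed
  then have "Inf {enat n |n. P n} \<in> {enat n |n. P n}"
    unfolding Inf_enat_def by (auto intro: LeastI)
  then show ?thesis
    using assms by auto
qed

lemma fibrewise_distance_attained:
  assumes "fibrewise_distance X pX Y pY r f = enat n"
  obtains U where "\<And>i. i \<le> n \<Longrightarrow> openin X (U i)" and "(\<Union>i\<le>n. U i) = topspace X"
    and "\<And>i s t. i \<le> n \<Longrightarrow> s \<in> {1..r} \<Longrightarrow> t \<in> {1..r} \<Longrightarrow>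
      fibrewise_homotopic (subtopology X (U i)) pX Y pY (f s) (f t)"
  using Inf_eq_enat_attained[OF assms[unfolded fibrewise_distance_def]] by metis

lemma fibrewise_cat_attained:
  assumes "fibrewise_cat X pX sX = enat n"
  obtains U where "\<And>i. i \<le> n \<Longrightarrow> openin X (U i)" and "(\<Union>i\<le>n. U i) = topspace X"
    and "\<And>i. i \<le> n \<Longrightarrow> fibrewise_homotopic (subtopology X (U i)) pX X pX id (sX \<circ> pX)"
  using Inf_eq_enat_attained[OF assms[unfolded fibrewise_cat_def]] by metis

text \<open>
  Covers indexed by a product are renumbered by \<open>k \<mapsto> (k div (n + 1), k mod (n + 1))\<close>.
\<close>

lemma fibrewise_distance_le_product_cover:
  assumes opn: "\<And>i j. i \<le> m \<Longrightarrow> j \<le> n \<Longrightarrow> openin X (W i j)"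
    and cov: "topspace X \<subseteq> (\<Union>i\<le>m. \<Union>j\<le>n. W i j)"
    and hom: "\<And>i j s t. i \<le> m \<Longrightarrow> j \<le> n \<Longrightarrow> s \<in> {1..r} \<Longrightarrow> t \<in> {1..r} \<Longrightarrow>
      fibrewise_homotopic (subtopology X (W i j)) pX Y pY (f s) (f t)"
  shows "fibrewise_distance X pX Y pY r f + 1 \<le> (enat n + 1) * (enat m + 1)"
proof -
  define N where "N = Suc m * Suc n - 1"
  define U where "U k = W (k div Suc n) (k mod Suc n)" for k
  have bounds: "k div Suc n \<le> m" "k mod Suc n \<le> n" if "k \<le> N" for k
  proof -
    have "k < Suc m * Suc n"
      using that by (simp add: N_def)
    then show "k div Suc n \<le> m"
      by (metis less_Suc_eq_le less_mult_imp_div_less)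
    show "k mod Suc n \<le> n"
      by (simp add: less_Suc_eq_le[symmetric])
  qed
  have "\<exists>k\<le>N. W i j = U k" if "i \<le> m" "j \<le> n" for i j
  proof (intro exI conjI)
    have "i * Suc n \<le> m * Suc n"
      using that(1) by (rule mult_le_mono1)
    then show "i * Suc n + j \<le> N"
      using that(2) by (simp add: N_def)
    have "(i * Suc n + j) div Suc n = i" "(i * Suc n + j) mod Suc n = j"
      using that(2) by (simp_all del: mult_Suc_right)
    then show "W i j = U (i * Suc n + j)"
      unfolding U_def by (simp only:)
  qed
  then have "topspace X \<subseteq> (\<Union>k\<le>N. U k)"
    using cov by fastforce
  moreover have "openin X (U k)" if "k \<le> N" for k
    unfolding U_def using bounds[OF that] by (rule opn)
  moreover have "fibrewise_homotopic (subtopology X (U k)) pX Y pY (f s) (f t)"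
    if "k \<le> N" "s \<in> {1..r}" "t \<in> {1..r}" for k s t
    unfolding U_def using bounds[OF that(1)] that(2,3) by (rule hom)
  ultimately have "fibrewise_distance X pX Y pY r f \<le> enat N"
    unfolding fibrewise_distance_def
    by (intro Inf_lower CollectI exI[of _ N] exI[of _ U] conjI refl subset_antisym)
       (auto dest: openin_subset)
  then have "fibrewise_distance X pX Y pY r f + 1 \<le> enat N + 1"
    by (rule add_right_mono)
  also have "\<dots> = (enat n + 1) * (enat m + 1)"
    by (simp add: N_def one_enat_def algebra_simps)
  finally show ?thesis .
qed

theorem theorem5p14:
  fixes B :: "'b topology"
    and X :: "'x topology" and X' :: "'y topology"
    and E :: "'e topology" and E' :: "'f topology"
    and pX :: "'x \<Rightarrow> 'b" and pX' :: "'y \<Rightarrow> 'b" and pE :: "'e \<Rightarrow> 'b" and pE' :: "'f \<Rightarrow> 'b"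
    and sX :: "'b \<Rightarrow> 'x" and sX' :: "'b \<Rightarrow> 'y"
    and \<pi> :: "'e \<Rightarrow> 'x" and \<pi>' :: "'f \<Rightarrow> 'y"
    and F :: "'e set" and F' :: "'f set"
    and r :: nat and f :: "nat \<Rightarrow> 'e \<Rightarrow> 'f"
  assumes "fibrewise_pointed_space B X pX sX"
    and "fibrewise_pointed_space B X' pX' sX'"
    and "fibrewise_space B E pE"
    and "fibrewise_space B E' pE'"
    and "fibrewise_fibration B E pE X pX \<pi>"
    and "fibrewise_fibration B E' pE' X' pX' \<pi>'"
    and "F = {e \<in> topspace E. \<pi> e \<in> sX ` topspace B}"
    and "F' = {e \<in> topspace E'. \<pi>' e \<in> sX' ` topspace B}"
    and "\<And>i. i \<in> {1..r} \<Longrightarrow> fibrewise_map E pE E' pE' (f i)"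
    and "\<And>i. i \<in> {1..r} \<Longrightarrow> f i ` F \<subseteq> F'"
  shows "fibrewise_distance E pE E' pE' r f + 1 \<le>
         (fibrewise_distance (subtopology E F) pE (subtopology E' F') pE' r f + 1) *
         (fibrewise_cat X pX sX + 1)"
proof (cases "fibrewise_distance (subtopology E F) pE (subtopology E' F') pE' r f = \<infinity> \<or>
    fibrewise_cat X pX sX = \<infinity>")
  case True
  then have "(fibrewise_distance (subtopology E F) pE (subtopology E' F') pE' r f + 1) *
      (fibrewise_cat X pX sX + 1) = \<infinity>"
    by (auto simp: imult_is_infinity)
  then show ?thesis
    by (simp only: enat_ord_simps)
next
  case False
  then obtain n m where
    n: "fibrewise_distance (subtopology E F) pE (subtopology E' F') pE' r f = enat n"
    and m: "fibrewise_cat X pX sX = enat m"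
    by auto
  obtain V where V: "\<And>j. j \<le> n \<Longrightarrow> openin (subtopology E F) (V j)"
    "(\<Union>j\<le>n. V j) = topspace (subtopology E F)"
    "\<And>j s t. j \<le> n \<Longrightarrow> s \<in> {1..r} \<Longrightarrow> t \<in> {1..r} \<Longrightarrow>
      fibrewise_homotopic (subtopology (subtopology E F) (V j)) pE (subtopology E' F') pE' (f s) (f t)"
    by (rule fibrewise_distance_attained[OF n]) (rule that)
  obtain U where U: "\<And>i. i \<le> m \<Longrightarrow> openin X (U i)" "(\<Union>i\<le>m. U i) = topspace X"
    "\<And>i. i \<le> m \<Longrightarrow> fibrewise_homotopic (subtopology X (U i)) pX X pX id (sX \<circ> pX)"
    by (rule fibrewise_cat_attained[OF m]) (rule that)
  have pi: "continuous_map E X \<pi>"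
    using assms(5) by (simp add: fibrewise_fibration_def fibrewise_map_def)
  have pX: "pX x \<in> topspace B" if "x \<in> topspace X" for x
    using assms(1) that continuous_map_image_subset_topspace
    unfolding fibrewise_pointed_space_def fibrewise_space_def by fastforce
  define S where "S i = {e \<in> topspace E. \<pi> e \<in> U i}" for i
  have "\<exists>d. fibrewise_map (subtopology E (S i)) pE (subtopology E F) pE d \<and>
      fibrewise_homotopic (subtopology E (S i)) pE E pE id d" if "i \<le> m" for i
  proof -
    have "(sX \<circ> pX) x \<in> sX ` topspace B" if "x \<in> topspace X" for x
      using pX[OF that] by simp
    from fibrewise_fibration_deformation[OF assms(5,3) U(3)[OF that] this] show ?thesis
      unfolding S_def assms(7) by blast
  qed
  then obtain d where
    d: "\<And>i. i \<le> m \<Longrightarrow> fibrewise_map (subtopology E (S i)) pE (subtopology E F) pE (d i)"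
    and id_d: "\<And>i. i \<le> m \<Longrightarrow> fibrewise_homotopic (subtopology E (S i)) pE E pE id (d i)"
    by metis
  define W where "W i j = {e \<in> topspace (subtopology E (S i)). d i e \<in> V j}" for i j
  have "fibrewise_distance E pE E' pE' r f + 1 \<le> (enat n + 1) * (enat m + 1)"
  proof (rule fibrewise_distance_le_product_cover)
    fix i j assume i: "i \<le> m" and j: "j \<le> n"
    have "openin E (S i)"
      unfolding S_def using pi U(1)[OF i] by (rule openin_continuous_map_preimage)
    moreover have "openin (subtopology E (S i)) (W i j)"
      unfolding W_def
    proof (rule openin_continuous_map_preimage)
      show "continuous_map (subtopology E (S i)) (subtopology E F) (d i)"
        using d[OF i] by (simp add: fibrewise_map_def)
    qed (rule V(1)[OF j])
    ultimately show "openin E (W i j)"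
      by (rule openin_trans_full[rotated])
    show "fibrewise_homotopic (subtopology E (W i j)) pE E' pE' (f s) (f t)"
      if "s \<in> {1..r}" "t \<in> {1..r}" for s t
      unfolding W_def using d[OF i] id_d[OF i] assms(9)[OF that(1)] assms(9)[OF that(2)] V(3)[OF j that]
      by (rule fibrewise_homotopic_on_deformed_preimage)
  next
    show "topspace E \<subseteq> (\<Union>i\<le>m. \<Union>j\<le>n. W i j)"
    proof
      fix e assume e: "e \<in> topspace E"
      then have "\<pi> e \<in> topspace X"
        using pi continuous_map_image_subset_topspace by fastforce
      then obtain i where i: "i \<le> m" "\<pi> e \<in> U i"
        using U(2) by blast
      then have eS: "e \<in> topspace (subtopology E (S i))"
        using e by (simp add: S_def)
      then have "d i e \<in> topspace (subtopology E F)"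
        using d[OF i(1)] continuous_map_image_subset_topspace
        unfolding fibrewise_map_def by fastforce
      then obtain j where "j \<le> n" "d i e \<in> V j"
        using V(2) by blast
      then show "e \<in> (\<Union>i\<le>m. \<Union>j\<le>n. W i j)"
        using i(1) eS by (auto simp: W_def)
    qed
  qed
  then show ?thesis
    by (simp only: n m)
qed

end
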